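(* Let $R$ be a hyperdark ceer. Then $R$ is not $\mathrm{c}$-realized by any finitely generated c.e.\ algebra of finite type; that is, there is no finitely generated c.e.\ algebra $A$ with finitely many operations having a c.e.\ presentation whose word problem $=_A$ satisfies $R \le_{\mathrm{c}} {=_A}$ and ${=_A} \le_{\mathrm{c}} R$.
   Context: A ceer is a computably enumerable equivalence relation on $\omega$; it is infinite if it has infinitely many equivalence classes. For equivalence relations $R,S$ on $\omega$, $R \le_{\mathrm{c}} S$ means there is a computable $f$ with $x \mathrel{R} y \Leftrightarrow f(x) \mathrel{S} f(y)$ for all $x,y$; $R\equiv_{\mathrm{c}} S$ means $R\le_{\mathrm{c}} S$ and $S \le_{\mathrm{c}} R$. A transversal of $R$ is a set $T\subseteq\omega$ whose distinct elements are pairwise $R$-inequivalent. A strong disjoint array is a sequence $(D_{f(n)})_{n\in\omega}$ of pairwise disjoint finite sets given by canonical indices, with $f$ computable; an infinite set is hyperimmune if no strong disjoint array has every member meeting it. A ceer is hyperdark if it is infinite and all of its infinite transversals are hyperimmune. A c.e.\ (positive) algebra $A$ is one having a c.e.\ presentation: an algebra $A_\omega$ of the same type with universe $\omega$ and computable operations, together with a ceer $=_A$ which is a congruence of $A_\omega$ such that $A\cong A_\omega/{=_A}$; $=_A$ is the word problem (of the presentation). A ceer $R$ is $\mathrm{c}$-realized by $A$ if $R\equiv_{\mathrm{c}} {=_A}$. *)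

theory Defs
  imports Main "HOL-Library.Nat_Bijection"
begin

text \<open>
  Programs for the partial recursive functions, with argument lists in place of explicit arities:
  a program restricted to argument lists of length \<open>n\<close> denotes an \<open>n\<close>-ary partial recursive
  function.  In \<open>Cn f gs\<close> all of \<open>gs\<close> must converge; \<open>Mn f\<close> is unbounded search, which
  requires \<open>f\<close> to converge below the least zero.
\<close>

datatype recf =
    Zero
  | Succ
  | Proj nat
  | Cn recf "recf list"
  | Pr recf recf
  | Mn recf

inductive reval :: "recf \<Rightarrow> nat list \<Rightarrow> nat \<Rightarrow> bool" where
  reval_Zero: "reval Zero xs 0"
| reval_Succ: "reval Succ [x] (Suc x)"
| reval_Proj: "i < length xs \<Longrightarrow> reval (Proj i) xs (xs ! i)"
| reval_Cn: "list_all2 (\<lambda>g y. reval g xs y) gs ys \<Longrightarrow> reval f ys z \<Longrightarrow> reval (Cn f gs) xs z"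
| reval_Pr_0: "reval f xs y \<Longrightarrow> reval (Pr f g) (0 # xs) y"
| reval_Pr_Suc: "reval (Pr f g) (n # xs) y \<Longrightarrow> reval g (n # y # xs) z \<Longrightarrow>
    reval (Pr f g) (Suc n # xs) z"
| reval_Mn: "reval f (n # xs) 0 \<Longrightarrow> (\<And>i. i < n \<Longrightarrow> \<exists>y. 0 < y \<and> reval f (i # xs) y) \<Longrightarrow>
    reval (Mn f) xs n"

definition computable :: "nat \<Rightarrow> (nat list \<Rightarrow> nat) \<Rightarrow> bool" where
  "computable n f \<longleftrightarrow> (\<exists>p. \<forall>xs. length xs = n \<longrightarrow> (\<forall>y. reval p xs y \<longleftrightarrow> y = f xs))"

definition computable1 :: "(nat \<Rightarrow> nat) \<Rightarrow> bool" where
  "computable1 f \<longleftrightarrow> computable 1 (\<lambda>xs. f (xs ! 0))"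

text \<open>Computably enumerable means being the domain of a partial recursive function.\<close>

definition ce_rel :: "nat rel \<Rightarrow> bool" where
  "ce_rel R \<longleftrightarrow> (\<exists>p. \<forall>x y. (x, y) \<in> R \<longleftrightarrow> (\<exists>z. reval p [x, y] z))"

definition ceer :: "nat rel \<Rightarrow> bool" where
  "ceer R \<longleftrightarrow> equiv UNIV R \<and> ce_rel R"

definition c_reducible :: "nat rel \<Rightarrow> nat rel \<Rightarrow> bool" (infix "\<le>\<^sub>c" 50) where
  "R \<le>\<^sub>c S \<longleftrightarrow> (\<exists>f. computable1 f \<and> (\<forall>x y. (x, y) \<in> R \<longleftrightarrow> (f x, f y) \<in> S))"

definition c_equivalent :: "nat rel \<Rightarrow> nat rel \<Rightarrow> bool" (infix "\<equiv>\<^sub>c" 50) where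
  "R \<equiv>\<^sub>c S \<longleftrightarrow> R \<le>\<^sub>c S \<and> S \<le>\<^sub>c R"

definition transversal :: "nat rel \<Rightarrow> nat set \<Rightarrow> bool" where
  "transversal R T \<longleftrightarrow> (\<forall>x\<in>T. \<forall>y\<in>T. x \<noteq> y \<longrightarrow> (x, y) \<notin> R)"

text \<open>
  The finite set with canonical index \<open>e\<close> is \<open>set_decode e\<close>, the set of positions of the
  digit 1 in the binary expansion of \<open>e\<close>.
\<close>

definition strong_disjoint_array :: "(nat \<Rightarrow> nat) \<Rightarrow> bool" where
  "strong_disjoint_array f \<longleftrightarrow> computable1 f \<and>
     (\<forall>m n. m \<noteq> n \<longrightarrow> set_decode (f m) \<inter> set_decode (f n) = {})"

definition hyperimmune :: "nat set \<Rightarrow> bool" where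
  "hyperimmune X \<longleftrightarrow> infinite X \<and>
     \<not> (\<exists>f. strong_disjoint_array f \<and> (\<forall>n. set_decode (f n) \<inter> X \<noteq> {}))"

definition hyperdark :: "nat rel \<Rightarrow> bool" where
  "hyperdark R \<longleftrightarrow> infinite (UNIV // R) \<and>
     (\<forall>T. transversal R T \<and> infinite T \<longrightarrow> hyperimmune T)"

text \<open>
  A type is a set of operation symbols with finite arities, constants having arity 0.  The
  interpretation of a symbol in an algebra matters only on argument lists over the universe
  whose length is the arity of the symbol.
\<close>

record 's algebra_type =
  symbols :: "'s set"
  arity :: "'s \<Rightarrow> nat"

record ('s, 'a) algebra =
  universe :: "'a set"
  interp :: "'s \<Rightarrow> 'a list \<Rightarrow> 'a"

definition args :: "'s algebra_type \<Rightarrow> ('s, 'a) algebra \<Rightarrow> 's \<Rightarrow> 'a list set" where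
  "args \<tau> A s = {xs. length xs = arity \<tau> s \<and> set xs \<subseteq> universe A}"

definition is_algebra :: "'s algebra_type \<Rightarrow> ('s, 'a) algebra \<Rightarrow> bool" where
  "is_algebra \<tau> A \<longleftrightarrow> universe A \<noteq> {} \<and>
     (\<forall>s\<in>symbols \<tau>. \<forall>xs\<in>args \<tau> A s. interp A s xs \<in> universe A)"

definition finite_type :: "'s algebra_type \<Rightarrow> bool" where
  "finite_type \<tau> \<longleftrightarrow> finite (symbols \<tau>)"

inductive_set generated :: "'s algebra_type \<Rightarrow> ('s, 'a) algebra \<Rightarrow> 'a set \<Rightarrow> 'a set"
  for \<tau> :: "'s algebra_type" and A :: "('s, 'a) algebra" and G :: "'a set" where
  generated_base: "x \<in> G \<Longrightarrow> x \<in> generated \<tau> A G"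
| generated_step: "s \<in> symbols \<tau> \<Longrightarrow> length xs = arity \<tau> s \<Longrightarrow>
    (\<And>x. x \<in> set xs \<Longrightarrow> x \<in> generated \<tau> A G) \<Longrightarrow> interp A s xs \<in> generated \<tau> A G"

definition finitely_generated :: "'s algebra_type \<Rightarrow> ('s, 'a) algebra \<Rightarrow> bool" where
  "finitely_generated \<tau> A \<longleftrightarrow>
     (\<exists>G. finite G \<and> G \<subseteq> universe A \<and> generated \<tau> A G = universe A)"

definition congruence :: "'s algebra_type \<Rightarrow> ('s, 'a) algebra \<Rightarrow> 'a rel \<Rightarrow> bool" where
  "congruence \<tau> A E \<longleftrightarrow> equiv (universe A) E \<and>
     (\<forall>s\<in>symbols \<tau>. \<forall>xs\<in>args \<tau> A s. \<forall>ys\<in>args \<tau> A s.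
        list_all2 (\<lambda>x y. (x, y) \<in> E) xs ys \<longrightarrow> (interp A s xs, interp A s ys) \<in> E)"

text \<open>
  When \<open>E\<close> is a congruence, all members of the union below coincide: they are the class of the
  value of the operation at any choice of representatives.
\<close>

definition quotient_algebra :: "('s, 'a) algebra \<Rightarrow> 'a rel \<Rightarrow> ('s, 'a set) algebra" where
  "quotient_algebra A E =
     \<lparr>universe = universe A // E,
      interp = (\<lambda>s Xs. \<Union>xs\<in>listset Xs. E `` {interp A s xs})\<rparr>"

definition isomorphism ::
    "'s algebra_type \<Rightarrow> ('s, 'a) algebra \<Rightarrow> ('s, 'b) algebra \<Rightarrow> ('a \<Rightarrow> 'b) \<Rightarrow> bool" where
  "isomorphism \<tau> A B h \<longleftrightarrow> bij_betw h (universe A) (universe B) \<and>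
     (\<forall>s\<in>symbols \<tau>. \<forall>xs\<in>args \<tau> A s. h (interp A s xs) = interp B s (map h xs))"

definition isomorphic :: "'s algebra_type \<Rightarrow> ('s, 'a) algebra \<Rightarrow> ('s, 'b) algebra \<Rightarrow> bool" where
  "isomorphic \<tau> A B \<longleftrightarrow> (\<exists>h. isomorphism \<tau> A B h)"

text \<open>In a presentation \<open>(N, E)\<close> of \<open>A\<close>, the ceer \<open>E\<close> is the word problem.\<close>

definition ce_presentation ::
    "'s algebra_type \<Rightarrow> ('s, 'a) algebra \<Rightarrow> ('s, nat) algebra \<Rightarrow> nat rel \<Rightarrow> bool" where
  "ce_presentation \<tau> A N E \<longleftrightarrow>
     is_algebra \<tau> N \<and> universe N = UNIV \<and>
     (\<forall>s\<in>symbols \<tau>. computable (arity \<tau> s) (interp N s)) \<and>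
     ceer E \<and> congruence \<tau> N E \<and>
     isomorphic \<tau> A (quotient_algebra N E)"

definition ce_algebra :: "'s algebra_type \<Rightarrow> ('s, 'a) algebra \<Rightarrow> bool" where
  "ce_algebra \<tau> A \<longleftrightarrow> is_algebra \<tau> A \<and> (\<exists>N E. ce_presentation \<tau> A N E)"

definition c_realized :: "'s algebra_type \<Rightarrow> nat rel \<Rightarrow> ('s, 'a) algebra \<Rightarrow> bool" where
  "c_realized \<tau> R A \<longleftrightarrow> (\<exists>N E. ce_presentation \<tau> A N E \<and> R \<equiv>\<^sub>c E)"

end

theory Submission imports Defs begin

text \<open>
  Let \<open>E\<close> be the word problem and let \<open>g\<close> reduce \<open>E\<close> to \<open>R\<close>.  As there are finitely many
  operations, all computable, there is a computable sequence \<open>b 0 \<le> b 1 \<le> \<dots>\<close> such that the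
  representatives of the generators are below \<open>b 0\<close> and every operation maps arguments below
  \<open>b n\<close> to a value below \<open>b (n + 1)\<close>.  Some number below \<open>b (n + 1)\<close> is \<open>E\<close>-inequivalent to all
  numbers below \<open>b n\<close>: otherwise the classes meeting \<open>{..<b n}\<close> would contain the generators and
  be closed under the operations, so that \<open>E\<close>, and hence \<open>R\<close>, would have finitely many classes.
  So the sets \<open>g ` {..<b (n + 1)} - g ` {..<b n}\<close> form a strong disjoint array, and each contains
  an element that is \<open>R\<close>-inequivalent to the members of all earlier ones; these elements
  form an infinite transversal that is not hyperimmune.
\<close>

section \<open>Closure properties of the computable functions\<close>

inductive_cases reval_Zero_elim: "reval Zero xs y"
inductive_cases reval_Succ_elim: "reval Succ xs y"
inductive_cases reval_Proj_elim: "reval (Proj i) xs y"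
inductive_cases reval_Cn_elim: "reval (Cn f gs) xs y"
inductive_cases reval_Pr_0_elim: "reval (Pr f g) (0 # xs) y"
inductive_cases reval_Pr_Suc_elim: "reval (Pr f g) (Suc n # xs) y"

lemma computable_cong:
  assumes "computable n f" and "\<And>xs. length xs = n \<Longrightarrow> f xs = g xs"
  shows "computable n g"
  using assms unfolding computable_def by metis

lemma computable_zero: "computable n (\<lambda>xs. 0)"
  unfolding computable_def
  by (rule exI[of _ Zero]) (auto intro: reval_Zero elim: reval_Zero_elim)

lemma computable_proj: "i < n \<Longrightarrow> computable n (\<lambda>xs. xs ! i)"
  unfolding computable_def
  by (rule exI[of _ "Proj i"]) (auto intro: reval_Proj elim: reval_Proj_elim)

lemma computable1_Suc: "computable1 Suc"
  unfolding computable1_def computable_def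
proof (intro exI[of _ Succ] allI impI)
  fix xs :: "nat list" and y
  assume "length xs = 1"
  then obtain x where "xs = [x]" by (auto simp: length_Suc_conv)
  then show "reval Succ xs y \<longleftrightarrow> y = Suc (xs ! 0)"
    by (auto intro: reval_Succ elim: reval_Succ_elim)
qed

lemma computable_compose:
  assumes f: "computable (length gs) f" and gs: "\<And>g. g \<in> set gs \<Longrightarrow> computable n g"
  shows "computable n (\<lambda>xs. f (map (\<lambda>g. g xs) gs))"
proof -
  obtain p where p: "\<And>xs y. length xs = length gs \<Longrightarrow> reval p xs y \<longleftrightarrow> y = f xs"
    using f unfolding computable_def by blast
  obtain q where q: "\<And>g xs y. g \<in> set gs \<Longrightarrow> length xs = n \<Longrightarrow> reval (q g) xs y \<longleftrightarrow> y = g xs"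
    using gs unfolding computable_def by metis
  have all2: "list_all2 (\<lambda>h y. reval h xs y) (map q gs) ys \<longleftrightarrow> ys = map (\<lambda>g. g xs) gs"
    if "length xs = n" for xs ys
    using that q by (auto simp: list_all2_conv_all_nth list_eq_iff_nth_eq)
  have "reval (Cn p (map q gs)) xs y \<longleftrightarrow> y = f (map (\<lambda>g. g xs) gs)" if "length xs = n" for xs y
  proof -
    have "reval (Cn p (map q gs)) xs y \<longleftrightarrow>
        (\<exists>ys. list_all2 (\<lambda>h y. reval h xs y) (map q gs) ys \<and> reval p ys y)"
      by (auto intro: reval_Cn elim: reval_Cn_elim)
    then show ?thesis using all2[OF that] p by simp
  qed
  then show ?thesis unfolding computable_def by blast
qed

lemma computable_compose1:
  assumes "computable1 f" and "computable n g"
  shows "computable n (\<lambda>xs. f (g xs))"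
  using computable_compose[of "[g]" "\<lambda>xs. f (xs ! 0)" n] assms by (simp add: computable1_def)

lemma computable_Suc: "computable n f \<Longrightarrow> computable n (\<lambda>xs. Suc (f xs))"
  by (rule computable_compose1[OF computable1_Suc])

lemma computable_const: "computable n (\<lambda>xs. k)"
  by (induction k) (auto intro: computable_zero computable_Suc)

lemma computable_rearrange:
  assumes "computable (length is) f" and "\<And>i. i \<in> set is \<Longrightarrow> i < n"
  shows "computable n (\<lambda>xs. f (map ((!) xs) is))"
  using computable_compose[of "map (\<lambda>i xs. xs ! i) is" f n] assms
  by (auto intro: computable_proj simp: o_def)

lemma map_nth_upt: "length xs = n \<Longrightarrow> map ((!) xs) [k..<n] = drop k xs"
  by (auto simp: list_eq_iff_nth_eq)

lemma computable_drop:
  assumes "computable n f"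
  shows "computable (k + n) (\<lambda>xs. f (drop k xs))"
proof -
  have "computable (k + n) (\<lambda>xs. f (map ((!) xs) [k..<k + n]))"
    using assms by (intro computable_rearrange) auto
  then show ?thesis by (rule computable_cong) (simp only: map_nth_upt)
qed

lemma computable_Pr:
  assumes f: "computable n f" and g: "computable (Suc (Suc n)) g"
  shows "computable (Suc n) (\<lambda>xs. rec_nat (f (tl xs)) (\<lambda>m y. g (m # y # tl xs)) (hd xs))"
proof -
  obtain p where p: "\<And>xs y. length xs = n \<Longrightarrow> reval p xs y \<longleftrightarrow> y = f xs"
    using f unfolding computable_def by blast
  obtain q where q: "\<And>xs y. length xs = Suc (Suc n) \<Longrightarrow> reval q xs y \<longleftrightarrow> y = g xs"
    using g unfolding computable_def by blast
  have "reval (Pr p q) (k # xs) y \<longleftrightarrow> y = rec_nat (f xs) (\<lambda>m y. g (m # y # xs)) k"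
    if "length xs = n" for xs k y
  proof (induction k arbitrary: y)
    case 0
    show ?case using p[OF that] by (auto intro: reval_Pr_0 elim: reval_Pr_0_elim)
  next
    case (Suc k)
    have "reval (Pr p q) (Suc k # xs) y \<longleftrightarrow>
        (\<exists>z. reval (Pr p q) (k # xs) z \<and> reval q (k # z # xs) y)"
      by (auto intro: reval_Pr_Suc elim: reval_Pr_Suc_elim)
    then show ?case using Suc.IH q that by simp
  qed
  then have "reval (Pr p q) xs y \<longleftrightarrow> y = rec_nat (f (tl xs)) (\<lambda>m y. g (m # y # tl xs)) (hd xs)"
    if "length xs = Suc n" for xs y
    using that by (cases xs) auto
  then show ?thesis unfolding computable_def by blast
qed

lemma computable_rec:
  assumes "computable n f" and "computable (Suc (Suc n)) g" and "computable n k"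
  shows "computable n (\<lambda>xs. rec_nat (f xs) (\<lambda>m y. g (m # y # xs)) (k xs))"
proof -
  let ?gs = "k # map (\<lambda>i xs. xs ! i) [0..<n]"
  have "computable n (\<lambda>xs. (\<lambda>zs. rec_nat (f (tl zs)) (\<lambda>m y. g (m # y # tl zs)) (hd zs))
      (map (\<lambda>h. h xs) ?gs))"
    using assms by (intro computable_compose) (auto intro: computable_Pr computable_proj)
  then show ?thesis
    by (rule computable_cong) (simp add: o_def map_nth_upt)
qed

lemma computable_add:
  assumes "computable n f" and "computable n g"
  shows "computable n (\<lambda>xs. f xs + g xs)"
proof -
  have "computable n (\<lambda>xs. rec_nat (f xs) (\<lambda>m y. (\<lambda>zs. Suc (zs ! 1)) (m # y # xs)) (g xs))"
    using assms by (intro computable_rec computable_Suc computable_proj) auto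
  moreover have "rec_nat a (\<lambda>m y. Suc y) k = a + k" for a k :: nat
    by (induction k) auto
  ultimately show ?thesis by simp
qed

lemma computable_pred:
  assumes "computable n f"
  shows "computable n (\<lambda>xs. f xs - 1)"
proof -
  have "computable n (\<lambda>xs. rec_nat 0 (\<lambda>m y. (\<lambda>zs. zs ! 0) (m # y # xs)) (f xs))"
    using assms by (intro computable_rec computable_proj computable_zero) auto
  moreover have "rec_nat 0 (\<lambda>m y. m) k = k - 1" for k :: nat
    by (cases k) auto
  ultimately show ?thesis by simp
qed

lemma computable_diff:
  assumes "computable n f" and "computable n g"
  shows "computable n (\<lambda>xs. f xs - g xs)"
proof -
  have "computable n (\<lambda>xs. rec_nat (f xs) (\<lambda>m y. (\<lambda>zs. zs ! 1 - 1) (m # y # xs)) (g xs))"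
    using assms by (intro computable_rec computable_pred computable_proj) auto
  moreover have "rec_nat a (\<lambda>m y. y - 1) k = a - k" for a k :: nat
    by (induction k) auto
  ultimately show ?thesis by simp
qed

lemma computable_power_2:
  assumes "computable n f"
  shows "computable n (\<lambda>xs. 2 ^ f xs)"
proof -
  have "computable n (\<lambda>xs. rec_nat 1 (\<lambda>m y. (\<lambda>zs. zs ! 1 + zs ! 1) (m # y # xs)) (f xs))"
    using assms by (intro computable_rec computable_add computable_proj computable_const) auto
  moreover have "rec_nat 1 (\<lambda>m y. y + y) k = (2 :: nat) ^ k" for k
    by (induction k) auto
  ultimately show ?thesis by simp
qed

lemma computable_sum:
  assumes "computable (Suc n) f" and "computable n k"
  shows "computable n (\<lambda>xs. \<Sum>i<k xs. f (i # xs))"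
proof -
  let ?is = "0 # [2..<Suc (Suc n)]"
  have "computable (Suc (Suc n)) (\<lambda>zs. f (map ((!) zs) ?is))"
    using assms(1) by (intro computable_rearrange) (auto simp del: upt_Suc)
  then have step: "computable (Suc (Suc n)) (\<lambda>zs. f (zs ! 0 # drop 2 zs))"
    by (rule computable_cong) (simp only: list.map map_nth_upt)
  have "computable n (\<lambda>xs.
      rec_nat 0 (\<lambda>m y. (\<lambda>zs. zs ! 1 + f (zs ! 0 # drop 2 zs)) (m # y # xs)) (k xs))"
    using assms(2) by (intro computable_rec computable_add step computable_proj computable_zero) auto
  moreover have "rec_nat 0 (\<lambda>m y. y + f (m # xs)) k = (\<Sum>i<k. f (i # xs))" for k xs
    by (induction k) auto
  ultimately show ?thesis by simp
qed

lemma computable_mult: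
  assumes "computable n f" and "computable n g"
  shows "computable n (\<lambda>xs. f xs * g xs)"
  using computable_sum[OF computable_drop[of n g 1, simplified, OF assms(2)] assms(1)] by simp

lemma computable1_iterate:
  assumes "computable1 f"
  shows "computable1 (\<lambda>n. (f ^^ n) a)"
proof -
  have "computable 1 (\<lambda>xs. rec_nat a (\<lambda>m y. (\<lambda>zs. f (zs ! 1)) (m # y # xs)) (xs ! 0))"
    by (intro computable_rec computable_const computable_proj computable_compose1[OF assms]) auto
  moreover have "rec_nat a (\<lambda>m y. f y) k = (f ^^ k) a" for k
    by (induction k) auto
  ultimately show ?thesis by (simp add: computable1_def)
qed

lemma computable1_set_encode_image:
  assumes g: "computable1 g"
  shows "computable1 (\<lambda>b. set_encode (g ` {..<b}))"
proof -
  let ?new = "\<lambda>c. 1 - (\<Sum>x<c. 1 - ((g x - g c) + (g c - g x)))"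
  have new: "?new c = (if g c \<in> g ` {..<c} then 0 else 1)" for c
  proof (cases "g c \<in> g ` {..<c}")
    case True
    then obtain x where "x < c" and "g x = g c" by auto
    then have "1 \<le> (\<Sum>x<c. 1 - ((g x - g c) + (g c - g x)))"
      using member_le_sum[of x "{..<c}" "\<lambda>x. 1 - ((g x - g c) + (g c - g x))"] by simp
    then show ?thesis using True by simp
  next
    case False
    then have "g x \<noteq> g c" if "x < c" for x using that by (metis imageI lessThan_iff)
    then have "1 - ((g x - g c) + (g c - g x)) = 0" if "x < c" for x
      using that by (cases "g x" "g c" rule: linorder_cases) auto
    then show ?thesis using False by simp
  qed
  have "(\<Sum>c<b. 2 ^ g c * ?new c) = set_encode (g ` {..<b})" for b
    unfolding new by (induction b) (simp_all add: lessThan_Suc insert_absorb)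
  moreover have "computable1 (\<lambda>b. \<Sum>c<b. 2 ^ g c * ?new c)"
  proof -
    have "computable 2 (\<lambda>xs. 1 - ((g (xs ! 0) - g (xs ! 1)) + (g (xs ! 1) - g (xs ! 0))))"
      by (intro computable_diff computable_add computable_const computable_compose1[OF g]
          computable_proj) auto
    then have "computable 1 (\<lambda>xs. \<Sum>x<xs ! 0. (\<lambda>xs. 1 -
        ((g (xs ! 0) - g (xs ! 1)) + (g (xs ! 1) - g (xs ! 0)))) (x # xs))"
      by (intro computable_sum computable_proj) (auto simp: numeral_2_eq_2)
    then have "computable1 (\<lambda>c. 2 ^ g c * ?new c)"
      unfolding computable1_def
      by (intro computable_mult computable_power_2 computable_diff computable_const
          computable_compose1[OF g] computable_proj) auto
    then have "computable 2 (\<lambda>xs. 2 ^ g (xs ! 0) * ?new (xs ! 0))"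
      by (rule computable_compose1) (simp add: computable_proj)
    then have "computable 1 (\<lambda>xs. \<Sum>c<xs ! 0. (\<lambda>xs. 2 ^ g (xs ! 0) * ?new (xs ! 0)) (c # xs))"
      by (intro computable_sum computable_proj) (auto simp: numeral_2_eq_2)
    then show ?thesis by (simp add: computable1_def)
  qed
  ultimately show ?thesis by simp
qed

text \<open>The first argument of \<open>f\<close> is the bound on the others, so that the induction on \<open>k\<close> can
  sum over one argument at a time.\<close>

lemma computable_bounded_aux:
  assumes "computable (Suc k) f"
  shows "\<exists>H. computable1 H \<and>
    (\<forall>b xs. length xs = k \<and> set xs \<subseteq> {..<b} \<longrightarrow> f (b # xs) \<le> H b)"
  using assms
proof (induction k arbitrary: f)
  case 0
  have "computable1 (\<lambda>b. f [b])"
    unfolding computable1_def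
    by (rule computable_cong[of 1 f]) (use 0 in \<open>auto simp: length_Suc_conv\<close>)
  then show ?case by auto
next
  case (Suc k)
  have "computable (Suc (Suc k)) (\<lambda>zs. f (map ((!) zs) (1 # 0 # [2..<Suc (Suc k)])))"
    using Suc.prems by (intro computable_rearrange) (auto simp del: upt_Suc)
  then have "computable (Suc (Suc k)) (\<lambda>zs. f (zs ! 1 # zs ! 0 # drop 2 zs))"
    by (rule computable_cong) (simp only: list.map map_nth_upt)
  then have "computable (Suc k)
      (\<lambda>xs. \<Sum>i<xs ! 0. (\<lambda>zs. f (zs ! 1 # zs ! 0 # drop 2 zs)) (i # xs))"
    by (intro computable_sum computable_proj) auto
  from Suc.IH[OF this] obtain H where H: "computable1 H" and
    bound: "\<And>b xs. length xs = k \<Longrightarrow> set xs \<subseteq> {..<b} \<Longrightarrow> (\<Sum>i<b. f (b # i # xs)) \<le> H b"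
    by auto
  have "f (b # xs) \<le> H b" if len: "length xs = Suc k" and sub: "set xs \<subseteq> {..<b}" for b xs
  proof -
    obtain x ys where xs: "xs = x # ys" using len by (cases xs) auto
    then have "f (b # x # ys) \<le> (\<Sum>i<b. f (b # i # ys))"
      using sub by (intro member_le_sum) auto
    also have "\<dots> \<le> H b" using len sub xs by (intro bound) auto
    finally show ?thesis using xs by simp
  qed
  then show ?case using H by blast
qed

lemma computable_bounded:
  assumes "computable k f"
  shows "\<exists>H. computable1 H \<and> (\<forall>b xs. length xs = k \<and> set xs \<subseteq> {..<b} \<longrightarrow> f xs < H b)"
proof -
  have "computable (Suc k) (\<lambda>xs. Suc (f (drop 1 xs)))"
    using computable_Suc[OF computable_drop[OF assms, of 1]] by simp
  from computable_bounded_aux[OF this] show ?thesis by (simp add: Suc_le_eq)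
qed

lemma computable_bounded_family:
  assumes "finite S" and "\<forall>s\<in>S. computable (k s) (f s)"
  shows "\<exists>H. computable1 H \<and>
    (\<forall>s\<in>S. \<forall>b xs. length xs = k s \<and> set xs \<subseteq> {..<b} \<longrightarrow> f s xs < H b)"
  using assms
proof (induction S rule: finite_induct)
  case empty
  show ?case using computable1_Suc by blast
next
  case (insert s S)
  then obtain H where H: "computable1 H"
    "\<And>t b xs. t \<in> S \<Longrightarrow> length xs = k t \<Longrightarrow> set xs \<subseteq> {..<b} \<Longrightarrow> f t xs < H b"
    by auto
  obtain H' where H': "computable1 H'"
    "\<And>b xs. length xs = k s \<Longrightarrow> set xs \<subseteq> {..<b} \<Longrightarrow> f s xs < H' b"
    using computable_bounded insert.prems by (metis insertI1)
  have "computable1 (\<lambda>b. H b + H' b)"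
    using H(1) H'(1) unfolding computable1_def by (rule computable_add)
  moreover have "\<forall>t\<in>insert s S. \<forall>b xs. length xs = k t \<and> set xs \<subseteq> {..<b} \<longrightarrow>
      f t xs < H b + H' b"
    using H(2) H'(2) by (auto intro: trans_less_add1 trans_less_add2)
  ultimately show ?case by blast
qed

section \<open>Word problems of finitely generated algebras\<close>

lemma finite_quotient_reducible:
  assumes "\<And>x y. (x, y) \<in> R \<longleftrightarrow> (f x, f y) \<in> E" and "finite (UNIV // E)"
  shows "finite (UNIV // R)"
proof -
  have "R `` {x} = f -` (E `` {f x})" for x using assms(1) by auto
  then have "UNIV // R \<subseteq> (\<lambda>Y. f -` Y) ` (UNIV // E)"
    by (auto simp: quotient_def)
  then show ?thesis using assms(2) finite_surj by blast
qed

lemma generated_meets_closed_set: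
  assumes h: "isomorphism \<tau> A (quotient_algebra N E) h"
    and G: "generated \<tau> A G = universe A"
    and base: "\<And>a. a \<in> G \<Longrightarrow> h a \<inter> K \<noteq> {}"
    and closed: "\<And>s xs. s \<in> symbols \<tau> \<Longrightarrow> length xs = arity \<tau> s \<Longrightarrow> set xs \<subseteq> K \<Longrightarrow>
      \<exists>y\<in>K. (interp N s xs, y) \<in> E"
    and a: "a \<in> universe A"
  shows "h a \<inter> K \<noteq> {}"
proof -
  have "a \<in> generated \<tau> A G" using a G by simp
  then show ?thesis
  proof (induction rule: generated.induct)
    case (generated_base x)
    then show ?case by (rule base)
  next
    case (generated_step s xs)
    define ks where "ks = map (\<lambda>x. SOME k. k \<in> h x \<inter> K) xs"
    have some: "(SOME k. k \<in> h x \<inter> K) \<in> h x \<inter> K" if "x \<in> set xs" for x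
      using generated_step.IH[OF that] by (metis ex_in_conv someI_ex)
    then have "set ks \<subseteq> K" unfolding ks_def by auto
    moreover have "length ks = arity \<tau> s" unfolding ks_def using generated_step by simp
    ultimately obtain y where y: "y \<in> K" "(interp N s ks, y) \<in> E"
      using closed[OF generated_step.hyps(1)] by blast
    have "ks \<in> listset (map h xs)"
      unfolding ks_def using some by (induction xs) (auto simp: set_Cons_def)
    moreover have "xs \<in> args \<tau> A s"
      unfolding args_def using generated_step G by auto
    then have "h (interp A s xs) = (\<Union>zs\<in>listset (map h xs). E `` {interp N s zs})"
      using h generated_step.hyps(1) unfolding isomorphism_def quotient_algebra_def by simp
    ultimately show ?case using y by blast
  qed
qed

lemma ex_new_class:
  assumes h: "isomorphism \<tau> A (quotient_algebra N E) h" and N: "universe N = UNIV"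
    and E: "equiv UNIV E" "infinite (UNIV // E)"
    and G: "generated \<tau> A G = universe A"
    and K: "finite K" and base: "\<And>a. a \<in> G \<Longrightarrow> h a \<inter> K \<noteq> {}"
  shows "\<exists>s\<in>symbols \<tau>. \<exists>xs. length xs = arity \<tau> s \<and> set xs \<subseteq> K \<and>
    (\<forall>y\<in>K. (interp N s xs, y) \<notin> E)"
proof (rule ccontr)
  assume "\<not> ?thesis"
  then have meets: "h a \<inter> K \<noteq> {}" if "a \<in> universe A" for a
    by (intro generated_meets_closed_set[OF h G base _ that]) blast+
  have "h ` universe A = UNIV // E"
    using h N unfolding isomorphism_def bij_betw_def quotient_algebra_def by simp
  then have "UNIV // E \<subseteq> (\<lambda>k. E `` {k}) ` K"
    using meets E(1) by (smt (verit) Image_singleton_iff disjoint_iff equiv_class_eq image_iff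
        quotientE subsetI)
  then show False using K E(2) finite_surj by blast
qed

section \<open>Hyperdark ceers\<close>

lemma hyperdark_no_increasing_array:
  assumes R: "refl R" "sym R" and hd: "hyperdark R"
    and g: "computable1 g" and b: "computable1 b" "mono b"
    and new: "\<And>n. \<exists>z<b (Suc n). \<forall>y<b n. (g z, g y) \<notin> R"
  shows False
proof -
  define T where "T n = g ` {..<b n}" for n
  have T_mono: "m \<le> n \<Longrightarrow> T m \<subseteq> T n" for m n
    unfolding T_def using monoD[OF b(2)] by (fastforce intro: order.strict_trans2)
  have fin: "finite (T n)" for n unfolding T_def by simp
  define f where "f n = set_encode (T (Suc n)) - set_encode (T n)" for n
  have f: "set_decode (f n) = T (Suc n) - T n" for n
  proof -
    have "f n = set_encode (T (Suc n) - T n)"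
      unfolding f_def set_encode_def using fin T_mono[of n "Suc n"] by (simp add: sum_diff_nat)
    then show ?thesis using fin by simp
  qed
  have "computable1 f"
    unfolding f_def T_def computable1_def
    by (intro computable_diff computable_compose1[OF computable1_set_encode_image[OF g]]
        computable_compose1[OF b(1)] computable_Suc computable_proj) auto
  moreover have "set_decode (f m) \<inter> set_decode (f n) = {}" if "m < n" for m n
    using T_mono[of "Suc m" n] that unfolding f by auto
  then have "set_decode (f m) \<inter> set_decode (f n) = {}" if "m \<noteq> n" for m n
    using that by (metis inf_commute linorder_neqE_nat)
  ultimately have array: "strong_disjoint_array f"
    unfolding strong_disjoint_array_def by blast
  have "\<forall>n. \<exists>x\<in>T (Suc n). \<forall>y\<in>T n. (x, y) \<notin> R"
    using new unfolding T_def by fastforce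
  then obtain x where x: "\<And>n. x n \<in> T (Suc n)" "\<And>n y. y \<in> T n \<Longrightarrow> (x n, y) \<notin> R"
    by metis
  have less: "(x n, x m) \<notin> R" if "m < n" for m n
    using x T_mono[of "Suc m" n] that by (meson Suc_leI subsetD)
  then have neq: "(x n, x m) \<notin> R" if "m \<noteq> n" for m n
    using that R(2) by (metis linorder_neqE_nat symD)
  then have "inj x" using R(1) by (metis injI reflD)
  then have "infinite (range x)" using finite_imageD infinite_UNIV_nat by blast
  moreover have "transversal R (range x)"
    unfolding transversal_def using neq by (metis imageE)
  ultimately have "hyperimmune (range x)" using hd unfolding hyperdark_def by blast
  moreover have "x n \<in> set_decode (f n)" for n
    unfolding f using x R(1) by (metis DiffI reflD)
  ultimately show False using array unfolding hyperimmune_def by blast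
qed

theorem theorem2p4:
  fixes R :: "nat rel"
    and \<tau> :: "'s algebra_type"
    and A :: "('s, 'a) algebra"
  assumes "ceer R" and "hyperdark R"
    and "finite_type \<tau>" and "ce_algebra \<tau> A" and "finitely_generated \<tau> A"
  shows "\<not> c_realized \<tau> R A"
proof
  assume "c_realized \<tau> R A"
  then obtain N E where pres: "ce_presentation \<tau> A N E" and RE: "R \<le>\<^sub>c E" and ER: "E \<le>\<^sub>c R"
    unfolding c_realized_def c_equivalent_def by blast
  obtain h where h: "isomorphism \<tau> A (quotient_algebra N E) h"
    using pres unfolding ce_presentation_def isomorphic_def by blast
  have N: "universe N = UNIV" and E: "equiv UNIV E"
    and ops: "\<forall>s\<in>symbols \<tau>. computable (arity \<tau> s) (interp N s)"
    using pres unfolding ce_presentation_def ceer_def by auto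
  have inf: "infinite (UNIV // E)"
    using RE assms(2) finite_quotient_reducible unfolding c_reducible_def hyperdark_def by metis
  obtain g where g: "computable1 g" "\<And>x y. (x, y) \<in> E \<longleftrightarrow> (g x, g y) \<in> R"
    using ER unfolding c_reducible_def by blast
  obtain G where G: "finite G" "G \<subseteq> universe A" "generated \<tau> A G = universe A"
    using assms(5) unfolding finitely_generated_def by blast
  obtain H where H: "computable1 H" and bound: "\<And>s b xs. s \<in> symbols \<tau> \<Longrightarrow>
      length xs = arity \<tau> s \<Longrightarrow> set xs \<subseteq> {..<b} \<Longrightarrow> interp N s xs < H b"
    using computable_bounded_family[OF _ ops] assms(3) unfolding finite_type_def by auto
  have "\<exists>k. k \<in> h a" if "a \<in> G" for a
  proof -
    have "h a \<in> UNIV // E"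
      using h N G(2) that unfolding isomorphism_def bij_betw_def quotient_algebra_def by auto
    then show ?thesis using E in_quotient_imp_non_empty by blast
  qed
  then obtain r where r: "\<And>a. a \<in> G \<Longrightarrow> r a \<in> h a" by metis
  obtain b0 where b0: "\<And>a. a \<in> G \<Longrightarrow> r a < b0"
    using G(1) finite_nat_set_iff_bounded[of "r ` G"] by auto
  define b where "b n = ((\<lambda>c. c + H c) ^^ n) b0" for n
  have b_Suc: "b (Suc n) = b n + H (b n)" for n unfolding b_def by simp
  have "computable1 (\<lambda>c. c + H c)"
    using H unfolding computable1_def by (intro computable_add computable_proj) auto
  then have "computable1 b" unfolding b_def by (rule computable1_iterate)
  moreover have "mono b" by (metis b_Suc le_add1 lift_Suc_mono_le monoI)
  moreover have "\<exists>z<b (Suc n). \<forall>y<b n. (g z, g y) \<notin> R" for n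
  proof -
    have "b 0 \<le> b n" using \<open>mono b\<close> by (rule monoD) simp
    then have "h a \<inter> {..<b n} \<noteq> {}" if "a \<in> G" for a
      using r[OF that] b0[OF that] unfolding b_def by (auto dest: order.strict_trans2)
    from ex_new_class[OF h N E inf G(3) finite_lessThan this]
    obtain s xs where s: "s \<in> symbols \<tau>" "length xs = arity \<tau> s" "set xs \<subseteq> {..<b n}"
      "\<forall>y<b n. (interp N s xs, y) \<notin> E" by auto
    moreover have "interp N s xs < b (Suc n)"
      using bound[OF s(1-3)] by (simp add: b_Suc)
    ultimately show ?thesis using g(2) by blast
  qed
  moreover have "refl R" "sym R"
    using assms(1) unfolding ceer_def equiv_def by auto
  ultimately show False
    using hyperdark_no_increasing_array[of R g b] assms(2) g(1) by blast
qed

end
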